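(* Let $Z=(X,Y)$ be a planar piecewise smooth vector field with discontinuity set $\{x=0\}$, equal to $X$ for $x>0$ and to $Y$ for $x<0$, and let $\varphi$ be a monotonic transition function. After $\varphi$-nonlinear regularization $Z_\varepsilon(x,y)=\widetilde Z\big(\varphi(\tfrac{x}{\varepsilon}),x,y\big)$ and directional blow-up, it is possible to generate normally hyperbolic points, SF-fold singularities, SF-transcritical singularities and SF-pitchfork singularities.
   Context: The vector field is $Z(z)=\frac{1+\operatorname{sgn}(x)}{2}X(z)+\frac{1-\operatorname{sgn}(x)}{2}Y(z)$, $z=(x,y)\in U\subset\mathbb{R}^2$, where $X,Y$ are $C^r$ vector fields on $U$, a neighbourhood of the origin, and $Z$ is regarded as multi-valued on $\{x=0\}$. A monotonic transition function is a sufficiently smooth $\varphi:\mathbb{R}\to\mathbb{R}$ with $\varphi(t)=-1$ for $t\le-1$, $\varphi(t)=1$ for $t\ge1$ and $\varphi'(t)>0$ for $t\in(-1,1)$. A $\varphi$-nonlinear regularization of $X$ and $Y$ is the one-parameter family $Z_\varepsilon(p)=\widetilde Z(\varphi(x/\varepsilon),p)$, $p=(x,y)\in U$, $\varepsilon>0$, where $\widetilde Z(\lambda,\cdot)=(\widetilde Z^1,\widetilde Z^2)(\lambda,\cdot)$, $\lambda\in[-1,1]$, is a one-parameter family of smooth vector fields with $\widetilde Z(-1,p)=Y(p)$ and $\widetilde Z(1,p)=X(p)$ for all $p\in U$. The directional blow-up $(\tilde x,\tilde y,\varepsilon)\mapsto(\varepsilon\tilde x,\tilde y,\varepsilon)$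 applied to $\dot z=Z_\varepsilon(z)$ gives (dropping tildes on the variables) the slow-fast system $$\varepsilon\dot x=f(x,y,\varepsilon)=\widetilde Z^1(\varphi(x),\varepsilon x,y),\qquad \dot y=g(x,y,\varepsilon)=\widetilde Z^2(\varphi(x),\varepsilon x,y).$$ For a planar slow-fast system $\varepsilon\dot x=f(x,y,\varepsilon)$, $\dot y=g(x,y,\varepsilon)$, the critical set is $C_0=\{f(x,y,0)=0\}$. For the origin in $C_0$, with all quantities evaluated at $(0,0,0)$ (SF- means singularity of the slow-fast system at $\varepsilon=0$): - the origin is a normally hyperbolic point if $f_x\ne0$; - the origin is an SF-(generic) fold if $f_x=0$, $f_{xx}\neq0$, $f_y\ne0$, $g\neq0$; - the origin is an SF-(generic) transcritical singularity if $f=f_x=f_y=0$, $\det\operatorname{Hes}(f)<0$, $f_{xx}\neq0$, $g\ne0$, where $\operatorname{Hes}(f)$ is the Hessian matrix of $f$ in $(x,y)$; - the origin is an SF-(generic) pitchfork singularity if $f=f_x=f_{xx}=f_y=0$, $f_{xxx}\neq0$, $f_{xy}\neq0$, $g\ne0$. *)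

theory Defs
  imports "HOL-Analysis.Analysis" "HOL-Library.Extended_Nat"
begin

type_synonym vector_field = "real \<times> real \<Rightarrow> real \<times> real"

(* Class C^n of a function on an open set, by iterating directional derivatives;
   in finite dimension this is the usual notion. *)
primrec Cn_on :: "nat \<Rightarrow> 'a::euclidean_space set \<Rightarrow> ('a \<Rightarrow> 'b::euclidean_space) \<Rightarrow> bool" where
  "Cn_on 0 S f \<longleftrightarrow> continuous_on S f"
| "Cn_on (Suc n) S f \<longleftrightarrow> (\<forall>x\<in>S. f differentiable (at x)) \<and>
     (\<forall>v. Cn_on n S (\<lambda>x. frechet_derivative f (at x) v))"

(* The index may be infinite, which gives class C^infinity. *)
definition Cr_on :: "enat \<Rightarrow> 'a::euclidean_space set \<Rightarrow> ('a \<Rightarrow> 'b::euclidean_space) \<Rightarrow> bool" where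
  "Cr_on r S f \<longleftrightarrow> (\<forall>n. enat n \<le> r \<longrightarrow> Cn_on n S f)"

definition piecewise_smooth_vf ::
  "enat \<Rightarrow> (real \<times> real) set \<Rightarrow> vector_field \<Rightarrow> vector_field \<Rightarrow> (real \<times> real \<Rightarrow> (real \<times> real) set) \<Rightarrow> bool"
  where
  "piecewise_smooth_vf r U X Y Z \<longleftrightarrow>
     open U \<and> (0, 0) \<in> U \<and> Cr_on r U X \<and> Cr_on r U Y \<and>
     (\<forall>z\<in>U. Z z = (if fst z > 0 then {X z} else if fst z < 0 then {Y z} else {X z, Y z}))"

(* C^3 is the smoothness needed for the third derivative in the pitchfork conditions. *)
definition monotonic_transition :: "(real \<Rightarrow> real) \<Rightarrow> bool" where
  "monotonic_transition \<phi> \<longleftrightarrow>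
     Cr_on 3 UNIV \<phi> \<and> (\<forall>t\<le>-1. \<phi> t = -1) \<and> (\<forall>t\<ge>1. \<phi> t = 1) \<and>
     (\<forall>t. -1 < t \<and> t < 1 \<longrightarrow> deriv \<phi> t > 0)"

(* Joint smoothness on the non-open set [-1,1] x U means smoothness on an open neighbourhood of it. *)
definition interpolating_family ::
  "enat \<Rightarrow> (real \<times> real) set \<Rightarrow> vector_field \<Rightarrow> vector_field \<Rightarrow> (real \<Rightarrow> vector_field) \<Rightarrow> bool"
  where
  "interpolating_family r U X Y Zt \<longleftrightarrow>
     (\<exists>V. open V \<and> {-1..1} \<times> U \<subseteq> V \<and> Cr_on r V (\<lambda>(l, p). Zt l p)) \<and>
     (\<forall>p\<in>U. Zt (-1) p = Y p \<and> Zt 1 p = X p)"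

definition nonlinear_regularization ::
  "(real \<Rightarrow> real) \<Rightarrow> (real \<Rightarrow> vector_field) \<Rightarrow> real \<Rightarrow> vector_field" where
  "nonlinear_regularization \<phi> Zt \<epsilon> p = Zt (\<phi> (fst p / \<epsilon>)) p"

lemma nonlinear_regularization_outside_strip:
  assumes "piecewise_smooth_vf r U X Y Z" "monotonic_transition \<phi>"
    and "interpolating_family s U X Y Zt" "\<epsilon> > 0" "p \<in> U" "\<bar>fst p\<bar> \<ge> \<epsilon>"
  shows "Z p = {nonlinear_regularization \<phi> Zt \<epsilon> p}"
proof (cases "fst p > 0")
  case True
  then have "fst p / \<epsilon> \<ge> 1" using assms by (simp add: field_simps)
  then show ?thesis using assms True
    unfolding piecewise_smooth_vf_def monotonic_transition_def interpolating_family_def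
      nonlinear_regularization_def by simp
next
  case False
  then have "fst p / \<epsilon> \<le> -1" "fst p < 0" using assms by (auto simp add: field_simps)
  then show ?thesis using assms False
    unfolding piecewise_smooth_vf_def monotonic_transition_def interpolating_family_def
      nonlinear_regularization_def by simp
qed

(* Right-hand sides of the slow-fast system  eps x' = f(x,y,eps),  y' = g(x,y,eps)  obtained from
   the regularized field by the directional blow-up (x,y,eps) |-> (eps x, y, eps). *)
definition blowup_fast ::
  "(real \<Rightarrow> real) \<Rightarrow> (real \<Rightarrow> vector_field) \<Rightarrow> real \<Rightarrow> real \<Rightarrow> real \<Rightarrow> real" where
  "blowup_fast \<phi> Zt x y \<epsilon> = fst (Zt (\<phi> x) (\<epsilon> * x, y))"

definition blowup_slow ::
  "(real \<Rightarrow> real) \<Rightarrow> (real \<Rightarrow> vector_field) \<Rightarrow> real \<Rightarrow> real \<Rightarrow> real \<Rightarrow> real" where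
  "blowup_slow \<phi> Zt x y \<epsilon> = snd (Zt (\<phi> x) (\<epsilon> * x, y))"

lemma blowup_solution_iff:
  assumes "\<epsilon> > 0"
  shows "((\<lambda>t. (\<epsilon> * x t, y t)) has_vector_derivative
            nonlinear_regularization \<phi> Zt \<epsilon> (\<epsilon> * x t, y t)) (at t) \<longleftrightarrow>
         (\<exists>x'. (x has_real_derivative x') (at t) \<and> \<epsilon> * x' = blowup_fast \<phi> Zt (x t) (y t) \<epsilon>) \<and>
         (y has_real_derivative blowup_slow \<phi> Zt (x t) (y t) \<epsilon>) (at t)"
    (is "?L \<longleftrightarrow> (\<exists>x'. ?P x' \<and> ?Q x') \<and> ?R")
proof -
  have eq: "nonlinear_regularization \<phi> Zt \<epsilon> (\<epsilon> * x t, y t) =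
      (blowup_fast \<phi> Zt (x t) (y t) \<epsilon>, blowup_slow \<phi> Zt (x t) (y t) \<epsilon>)"
    using assms by (simp add: nonlinear_regularization_def blowup_fast_def blowup_slow_def)
  show ?thesis
  proof
    assume L: ?L
    have d: "((\<lambda>t. fst (\<epsilon> * x t, y t)) has_vector_derivative
                fst (blowup_fast \<phi> Zt (x t) (y t) \<epsilon>, blowup_slow \<phi> Zt (x t) (y t) \<epsilon>)) (at t)"
            "((\<lambda>t. snd (\<epsilon> * x t, y t)) has_vector_derivative
                snd (blowup_fast \<phi> Zt (x t) (y t) \<epsilon>, blowup_slow \<phi> Zt (x t) (y t) \<epsilon>)) (at t)"
      using bounded_linear.has_vector_derivative[OF bounded_linear_fst L[unfolded eq]]
        bounded_linear.has_vector_derivative[OF bounded_linear_snd L[unfolded eq]] by auto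
    have "((\<lambda>t. \<epsilon> * x t) has_real_derivative blowup_fast \<phi> Zt (x t) (y t) \<epsilon>) (at t)"
      using d(1) by (simp add: has_real_derivative_iff_has_vector_derivative)
    from DERIV_cmult[OF this, of "inverse \<epsilon>"]
    have "(x has_real_derivative blowup_fast \<phi> Zt (x t) (y t) \<epsilon> / \<epsilon>) (at t)"
      using assms by (simp add: field_simps)
    then show "(\<exists>x'. ?P x' \<and> ?Q x') \<and> ?R"
      using d(2) assms by (auto simp: has_real_derivative_iff_has_vector_derivative
          intro!: exI[of _ "blowup_fast \<phi> Zt (x t) (y t) \<epsilon> / \<epsilon>"])
  next
    assume "(\<exists>x'. ?P x' \<and> ?Q x') \<and> ?R"
    then obtain x' where x': "?P x'" "?Q x'" and R: ?R by blast
    have "((\<lambda>t. \<epsilon> * x t) has_vector_derivative blowup_fast \<phi> Zt (x t) (y t) \<epsilon>) (at t)"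
      using DERIV_cmult[OF x'(1), of \<epsilon>] x'(2)
      by (simp add: has_real_derivative_iff_has_vector_derivative)
    then show ?L unfolding eq
      using R by (auto intro!: has_vector_derivative_Pair
          simp: has_real_derivative_iff_has_vector_derivative)
  qed
qed

definition partial_x :: "(real \<Rightarrow> real \<Rightarrow> real) \<Rightarrow> real \<Rightarrow> real \<Rightarrow> real" where
  "partial_x F x y = deriv (\<lambda>s. F s y) x"

definition partial_y :: "(real \<Rightarrow> real \<Rightarrow> real) \<Rightarrow> real \<Rightarrow> real \<Rightarrow> real" where
  "partial_y F x y = deriv (\<lambda>s. F x s) y"

definition Hessian :: "(real \<Rightarrow> real \<Rightarrow> real) \<Rightarrow> real \<Rightarrow> real \<Rightarrow> real^2^2" where
  "Hessian F x y = vector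
     [vector [partial_x (partial_x F) x y, partial_y (partial_x F) x y],
      vector [partial_x (partial_y F) x y, partial_y (partial_y F) x y]]"

(* Smoothness is required so that the derivatives used below exist ("deriv" is total). *)
definition slow_fast_near_origin ::
  "(real \<Rightarrow> real \<Rightarrow> real \<Rightarrow> real) \<Rightarrow> (real \<Rightarrow> real \<Rightarrow> real \<Rightarrow> real) \<Rightarrow> bool" where
  "slow_fast_near_origin f g \<longleftrightarrow>
     (\<exists>N. open N \<and> (0, 0, 0) \<in> N \<and>
       Cr_on 3 N (\<lambda>(x, y, \<epsilon>). f x y \<epsilon>) \<and> Cr_on 3 N (\<lambda>(x, y, \<epsilon>). g x y \<epsilon>))"

definition critical_set :: "(real \<Rightarrow> real \<Rightarrow> real \<Rightarrow> real) \<Rightarrow> (real \<times> real) set" where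
  "critical_set f = {(x, y). f x y 0 = 0}"

definition normally_hyperbolic_origin ::
  "(real \<Rightarrow> real \<Rightarrow> real \<Rightarrow> real) \<Rightarrow> (real \<Rightarrow> real \<Rightarrow> real \<Rightarrow> real) \<Rightarrow> bool" where
  "normally_hyperbolic_origin f g \<longleftrightarrow>
     slow_fast_near_origin f g \<and> (0, 0) \<in> critical_set f \<and>
     (let F = (\<lambda>x y. f x y 0) in partial_x F 0 0 \<noteq> 0)"

definition SF_fold_origin ::
  "(real \<Rightarrow> real \<Rightarrow> real \<Rightarrow> real) \<Rightarrow> (real \<Rightarrow> real \<Rightarrow> real \<Rightarrow> real) \<Rightarrow> bool" where
  "SF_fold_origin f g \<longleftrightarrow>
     slow_fast_near_origin f g \<and> (0, 0) \<in> critical_set f \<and>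
     (let F = (\<lambda>x y. f x y 0) in
        partial_x F 0 0 = 0 \<and> partial_x (partial_x F) 0 0 \<noteq> 0 \<and> partial_y F 0 0 \<noteq> 0) \<and>
     g 0 0 0 \<noteq> 0"

definition SF_transcritical_origin ::
  "(real \<Rightarrow> real \<Rightarrow> real \<Rightarrow> real) \<Rightarrow> (real \<Rightarrow> real \<Rightarrow> real \<Rightarrow> real) \<Rightarrow> bool" where
  "SF_transcritical_origin f g \<longleftrightarrow>
     slow_fast_near_origin f g \<and> (0, 0) \<in> critical_set f \<and>
     (let F = (\<lambda>x y. f x y 0) in
        partial_x F 0 0 = 0 \<and> partial_y F 0 0 = 0 \<and> det (Hessian F 0 0) < 0 \<and>
        partial_x (partial_x F) 0 0 \<noteq> 0) \<and>
     g 0 0 0 \<noteq> 0"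

definition SF_pitchfork_origin ::
  "(real \<Rightarrow> real \<Rightarrow> real \<Rightarrow> real) \<Rightarrow> (real \<Rightarrow> real \<Rightarrow> real \<Rightarrow> real) \<Rightarrow> bool" where
  "SF_pitchfork_origin f g \<longleftrightarrow>
     slow_fast_near_origin f g \<and> (0, 0) \<in> critical_set f \<and>
     (let F = (\<lambda>x y. f x y 0) in
        partial_x F 0 0 = 0 \<and> partial_x (partial_x F) 0 0 = 0 \<and> partial_y F 0 0 = 0 \<and>
        partial_x (partial_x (partial_x F)) 0 0 \<noteq> 0 \<and> partial_y (partial_x F) 0 0 \<noteq> 0) \<and>
     g 0 0 0 \<noteq> 0"

end

theory Submission
  imports Defs "HOL-Real_Asymp.Real_Asymp"
begin

text \<open>
  Put \<open>c = \<phi> 0\<close>, which lies strictly between \<open>-1\<close> and \<open>1\<close>. With smooth cutoffs \<open>a\<close> and \<open>b\<close> that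
  vanish near \<open>c\<close> and satisfy \<open>a 1 = b (-1) = 1\<close>, \<open>a (-1) = b 1 = 0\<close>, the family
  \<open>a X + b Y + (1 - a - b) W\<close> interpolates between \<open>Y\<close> and \<open>X\<close> and coincides with \<open>W\<close> near \<open>\<lambda> = c\<close>.
  Near the origin the blown-up system is therefore the one generated by \<open>W\<close> alone, whatever the
  smoothness of \<open>X\<close> and \<open>Y\<close>. Since \<open>\<phi>' 0 > 0\<close>, the substitution \<open>u = \<phi> x - c\<close> is a change of
  coordinate, and \<open>W = (P (\<lambda> - c) y, 1)\<close> with \<open>P u y\<close> equal to \<open>u\<close>, \<open>y + u\<^sup>2\<close>, \<open>u\<^sup>2 - y\<^sup>2\<close>,
  \<open>u y - u\<^sup>3\<close> produces the four normal forms.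
\<close>

section \<open>Calculus of \<open>C\<^sup>n\<close> functions\<close>

text \<open>Since \<open>S\<close> is open, functions that agree on \<open>S\<close> agree near each
  of its points, hence have the same derivatives there at every order.\<close>

lemma Cn_on_cong:
  assumes "open S" "\<And>x. x \<in> S \<Longrightarrow> f x = g x"
  shows "Cn_on n S f \<longleftrightarrow> Cn_on n S g"
  using assms(2)
proof (induction n arbitrary: f g)
  case 0
  then show ?case by (simp cong: continuous_on_cong)
next
  case (Suc n)
  have deriv: "(h has_derivative D) (at x)"
    if "(k has_derivative D) (at x)" "\<And>x. x \<in> S \<Longrightarrow> k x = h x" "x \<in> S" for k h :: "'a \<Rightarrow> 'b" and D x
    by (rule has_derivative_transform_within_open[OF that(1) assms(1) that(3,2)])
  have "f differentiable (at x) \<longleftrightarrow> g differentiable (at x)" if "x \<in> S" for x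
    unfolding differentiable_def using deriv[of f _ x g] deriv[of g _ x f] Suc.prems that by metis
  \<comment> \<open>\<open>frechet_derivative\<close> is a choice operator, so it suffices that
    \<open>f\<close> and \<open>g\<close> have the same set of derivatives at \<open>x\<close>,
    which also covers the case of an empty set.\<close>
  moreover have "frechet_derivative f (at x) = frechet_derivative g (at x)" if "x \<in> S" for x
    unfolding frechet_derivative_def using deriv[of f _ x g] deriv[of g _ x f] Suc.prems that
    by (intro arg_cong[where f = Eps] ext) metis
  then have "Cn_on n S (\<lambda>x. frechet_derivative f (at x) v) = Cn_on n S (\<lambda>x. frechet_derivative g (at x) v)" for v
    by (intro Suc.IH) simp
  ultimately show ?case by simp
qed

text \<open>Replaces the chosen \<open>frechet_derivative\<close> by an explicit derivative, so that
  closure properties reduce to a differentiation rule and the smoothness of its right-hand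
  side.\<close>

lemma Cn_on_SucI:
  assumes "open S" and "\<And>x. x \<in> S \<Longrightarrow> (f has_derivative f' x) (at x)"
    and "\<And>v. Cn_on n S (\<lambda>x. f' x v)"
  shows "Cn_on (Suc n) S f"
proof -
  have "frechet_derivative f (at x) v = f' x v" if "x \<in> S" for x v
    using frechet_derivative_at[OF assms(2)[OF that]] by simp
  then have "Cn_on n S (\<lambda>x. frechet_derivative f (at x) v)" for v
    using Cn_on_cong[OF assms(1), of "\<lambda>x. frechet_derivative f (at x) v" "\<lambda>x. f' x v"] assms(3) by simp
  then show ?thesis using assms(2) by (auto simp: differentiable_def)
qed

lemma Cn_on_has_derivative:
  assumes "Cn_on (Suc n) S f" "x \<in> S"
  shows "(f has_derivative frechet_derivative f (at x)) (at x)"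
  using assms by (simp flip: frechet_derivative_works)

lemma Cn_on_frechet_derivative:
  "Cn_on (Suc n) S f \<Longrightarrow> Cn_on n S (\<lambda>x. frechet_derivative f (at x) v)"
  by simp

lemma Cn_on_Suc_imp:
  "Cn_on (Suc n) S f \<Longrightarrow> Cn_on n S f"
proof (induction n arbitrary: f)
  case 0
  then show ?case
    by (auto intro!: continuous_at_imp_continuous_on differentiable_imp_continuous_within)
next
  case (Suc n)
  have "Cn_on n S (\<lambda>x. frechet_derivative f (at x) v)" for v
    by (rule Suc.IH[OF Cn_on_frechet_derivative[OF Suc.prems]])
  moreover have "f differentiable (at x)" if "x \<in> S" for x
    using Cn_on_has_derivative[OF Suc.prems that] by (rule differentiableI)
  ultimately show ?case by (simp only: Cn_on.simps) blast
qed

lemma Cn_on_const: "open S \<Longrightarrow> Cn_on n S (\<lambda>x. c)"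
proof (induction n arbitrary: c)
  case (Suc n)
  then show ?case by (intro Cn_on_SucI[OF _ has_derivative_const]) auto
qed simp

lemma Cn_on_bounded_linear:
  assumes "open S" "bounded_linear L"
  shows "Cn_on n S L"
proof (cases n)
  case 0
  then show ?thesis using assms by (simp add: linear_continuous_on)
next
  case (Suc m)
  show ?thesis unfolding Suc
    by (rule Cn_on_SucI[OF assms(1) bounded_linear_imp_has_derivative[OF assms(2)]])
      (use assms in \<open>auto intro: Cn_on_const\<close>)
qed

lemma Cn_on_add:
  assumes "open S"
  shows "Cn_on n S f \<Longrightarrow> Cn_on n S g \<Longrightarrow> Cn_on n S (\<lambda>x. f x + g x)"
proof (induction n arbitrary: f g)
  case 0
  then show ?case by (simp add: continuous_on_add)
next
  case (Suc n)
  show ?case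
    by (rule Cn_on_SucI[OF assms has_derivative_add[OF Cn_on_has_derivative[OF Suc.prems(1)]
            Cn_on_has_derivative[OF Suc.prems(2)]]])
      (use assms Suc in auto)
qed

lemma Cn_on_scaleR:
  fixes f :: "'a::euclidean_space \<Rightarrow> real" and g :: "'a \<Rightarrow> 'b::euclidean_space"
  assumes "open S"
  shows "Cn_on n S f \<Longrightarrow> Cn_on n S g \<Longrightarrow> Cn_on n S (\<lambda>x. f x *\<^sub>R g x)"
proof (induction n arbitrary: f g)
  case 0
  then show ?case by (simp add: continuous_on_scaleR)
next
  case (Suc n)
  have "Cn_on n S (\<lambda>x. f x *\<^sub>R frechet_derivative g (at x) v + frechet_derivative f (at x) v *\<^sub>R g x)" for v
    by (intro Cn_on_add[OF assms] Suc.IH Cn_on_Suc_imp[OF Suc.prems(1)] Cn_on_Suc_imp[OF Suc.prems(2)]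
        Cn_on_frechet_derivative[OF Suc.prems(1)] Cn_on_frechet_derivative[OF Suc.prems(2)])
  then show ?case
    by (intro Cn_on_SucI[OF assms has_derivative_scaleR[OF Cn_on_has_derivative[OF Suc.prems(1)]
            Cn_on_has_derivative[OF Suc.prems(2)]]]) (use assms in auto)
qed

lemmas Cn_on_mult = Cn_on_scaleR[where 'b = real, unfolded real_scaleR_def]

text \<open>By the chain rule the derivative in direction \<open>v\<close> is the derivative of
  \<open>f\<close> in the fixed direction \<open>L v\<close>, again composed with \<open>L\<close>,
  so the induction hypothesis applies directly.\<close>

lemma Cn_on_compose_linear:
  assumes "open S" "bounded_linear L"
  shows "Cn_on n S f \<Longrightarrow> Cn_on n (L -` S) (\<lambda>x. f (L x))"
proof (induction n arbitrary: f)
  case 0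
  then show ?case
    using continuous_on_compose2[OF _ linear_continuous_on[OF assms(2)], of S f "L -` S"] by auto
next
  case (Suc n)
  have op: "open (L -` S)"
    using assms by (intro open_vimage linear_continuous_on)
  show ?case
  proof (rule Cn_on_SucI[OF op])
    show "((\<lambda>x. f (L x)) has_derivative (\<lambda>v. frechet_derivative f (at (L x)) (L v))) (at x)"
      if "x \<in> L -` S" for x
      by (rule has_derivative_compose[OF bounded_linear_imp_has_derivative[OF assms(2)]
            Cn_on_has_derivative[OF Suc.prems]]) (use that in simp)
    show "Cn_on n (L -` S) (\<lambda>x. frechet_derivative f (at (L x)) (L v))" for v
      by (rule Suc.IH[OF Cn_on_frechet_derivative[OF Suc.prems]])
  qed
qed

text \<open>A linear map on the reals is multiplication by its value at 1, so the chain rule gives a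
  product of \<open>?f' (g x)\<close> and a derivative of \<open>g\<close>. The induction varies
  \<open>f\<close> and keeps \<open>g\<close>.\<close>

lemma Cn_on_compose_real:
  fixes f :: "real \<Rightarrow> real"
  assumes "open S"
  shows "Cn_on n UNIV f \<Longrightarrow> Cn_on n S g \<Longrightarrow> Cn_on n S (\<lambda>x. f (g x))"
proof (induction n arbitrary: f)
  case 0
  then show ?case using continuous_on_compose2[of UNIV f S g] by simp
next
  case (Suc n)
  let ?f' = "\<lambda>x. frechet_derivative f (at x) 1"
  have f: "(f has_derivative (\<lambda>v. v * ?f' x)) (at x)" for x
  proof -
    have d: "(f has_derivative frechet_derivative f (at x)) (at x)"
      by (rule Cn_on_has_derivative[OF Suc.prems(1) UNIV_I])
    have "frechet_derivative f (at x) v = v * ?f' x" for v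
      using linear_cmul[OF has_derivative_linear[OF d], of v 1] by simp
    then show ?thesis
      by (rule has_derivative_eq_rhs[OF d ext])
  qed
  show ?case
  proof (rule Cn_on_SucI[OF assms])
    show "((\<lambda>x. f (g x)) has_derivative (\<lambda>v. frechet_derivative g (at x) v * ?f' (g x))) (at x)"
      if "x \<in> S" for x
      by (rule has_derivative_compose[OF Cn_on_has_derivative[OF Suc.prems(2) that] f])
    show "Cn_on n S (\<lambda>x. frechet_derivative g (at x) v * ?f' (g x))" for v
      by (rule Cn_on_mult[OF assms Cn_on_frechet_derivative[OF Suc.prems(2)]
            Suc.IH[OF Cn_on_frechet_derivative[OF Suc.prems(1)] Cn_on_Suc_imp[OF Suc.prems(2)]]])
  qed
qed

section \<open>Smooth cutoffs\<close>

text \<open>The derivative of \<open>p (1/x) exp (-1/x)\<close> is \<open>q (1/x) exp (-1/x)\<close> with \<open>q = t\<^sup>2 (p - p')\<close>, so this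
  class of functions is closed under differentiation.\<close>

definition flat :: "real poly \<Rightarrow> real \<Rightarrow> real" where
  "flat p x = (if x > 0 then poly p (1 / x) * exp (- (1 / x)) else 0)"

lemma poly_exp_minus_tendsto_0:
  fixes p :: "real poly"
  shows "((\<lambda>t. poly p t * exp (- t)) \<longlongrightarrow> 0) at_top"
proof (induction p)
  case 0
  then show ?case by simp
next
  case (pCons a p)
  have "((\<lambda>t::real. a * exp (- t)) \<longlongrightarrow> 0) at_top" by real_asymp
  moreover have "((\<lambda>t. t * (poly p t * exp (- t))) \<longlongrightarrow> 0) at_top"
  proof -
    \<comment> \<open>The polynomial is expanded because \<open>real_asymp\<close> can treat a
      monomial times \<open>exp (- t)\<close> with symbolic exponent \<open>i\<close>.\<close>
    have "((\<lambda>t. (\<Sum>i\<le>degree p. coeff p i * (t * t ^ i * exp (- t)))) \<longlongrightarrow> (\<Sum>i\<le>degree p. coeff p i * 0)) at_top"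
      by (intro tendsto_intros) real_asymp
    moreover have "(\<Sum>i\<le>degree p. coeff p i * (t * t ^ i * exp (- t))) = t * (poly p t * exp (- t))" for t
      by (simp add: poly_altdef sum_distrib_left sum_distrib_right mult_ac)
    ultimately show ?thesis by simp
  qed
  ultimately show ?case
    using tendsto_add[of "\<lambda>t. a * exp (- t)" 0 at_top "\<lambda>t. t * (poly p t * exp (- t))" 0]
    by (simp add: algebra_simps)
qed

lemma flat_tendsto_0: "(flat p \<longlongrightarrow> 0) (at_right 0)"
proof -
  have "((\<lambda>x. poly p (1 / x) * exp (- (1 / x))) \<longlongrightarrow> 0) (at_right (0::real))"
    by (rule filterlim_compose[OF poly_exp_minus_tendsto_0]) real_asymp
  then show ?thesis
    by (rule Lim_transform_eventually)
      (auto simp: flat_def eventually_at_right_field intro!: exI[of _ 1])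
qed

lemma flat_has_real_derivative:
  "(flat p has_real_derivative flat ([:0, 0, 1:] * (p - pderiv p)) x) (at x)"
proof -
  consider "x > 0" | "x < 0" | "x = 0" by linarith
  then show ?thesis
  proof cases
    case 1
    have "((\<lambda>x. poly p (1 / x) * exp (- (1 / x))) has_real_derivative
        flat ([:0, 0, 1:] * (p - pderiv p)) x) (at x)"
      using 1 by (auto intro!: derivative_eq_intros DERIV_chain2[OF poly_DERIV]
          simp: flat_def field_simps power2_eq_square)
    then show ?thesis
      by (rule has_field_derivative_transform_within_open[where S = "{0<..}"]) (use 1 in \<open>auto simp: flat_def\<close>)
  next
    case 2
    have "((\<lambda>x. 0) has_real_derivative flat ([:0, 0, 1:] * (p - pderiv p)) x) (at x)"
      using 2 by (simp add: flat_def)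
    then show ?thesis
      by (rule has_field_derivative_transform_within_open[where S = "{..<0}"]) (use 2 in \<open>auto simp: flat_def\<close>)
  next
    case 3
    have "((\<lambda>h. flat p h / h) \<longlongrightarrow> 0) (at 0)"
    proof (rule filterlim_split_at)
      \<comment> \<open>Dividing by \<open>h\<close> multiplies the polynomial by its variable
        \<open>1 / h\<close>, so for \<open>h > 0\<close> the quotient is
        \<open>flat ([:0, 1:] * p) h\<close>.\<close>
      show "((\<lambda>h. flat p h / h) \<longlongrightarrow> 0) (at_right 0)"
        by (rule Lim_transform_eventually[OF flat_tendsto_0[of "[:0, 1:] * p"]])
          (auto simp: flat_def eventually_at_right_field intro!: exI[of _ 1])
      show "((\<lambda>h. flat p h / h) \<longlongrightarrow> 0) (at_left 0)"
        by (rule Lim_transform_eventually[OF tendsto_const])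
          (auto simp: flat_def eventually_at_left_field intro!: exI[of _ "-1"])
    qed
    then show ?thesis using 3 by (simp add: DERIV_def flat_def)
  qed
qed

lemma Cn_on_flat: "Cn_on n UNIV (flat p)"
proof (induction n arbitrary: p)
  case 0
  show ?case
    by (auto intro!: continuous_at_imp_continuous_on DERIV_isCont[OF flat_has_real_derivative])
next
  case (Suc n)
  show ?case
  proof (rule Cn_on_SucI[OF open_UNIV])
    show "(flat p has_derivative (\<lambda>v. flat ([:0, 0, 1:] * (p - pderiv p)) x * v)) (at x)" for x
      using flat_has_real_derivative[of p x] by (simp only: has_field_derivative_def)
    show "Cn_on n UNIV (\<lambda>x. flat ([:0, 0, 1:] * (p - pderiv p)) x * v)" for v
      by (rule Cn_on_mult[OF open_UNIV Suc.IH Cn_on_const[OF open_UNIV]])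
  qed
qed

text \<open>The function exp(-1/x), extended by 0, is shifted to start at \<open>s\<close> and
  rescaled at \<open>t\<close>. No plateau beyond \<open>t\<close> is asked for, since the
  interpolation prescribes values only at \<lambda> = -1 and \<lambda> = 1.\<close>

lemma ex_smooth_cutoff:
  fixes s t :: real
  assumes "s < t"
  shows "\<exists>a :: real \<Rightarrow> real. (\<forall>n. Cn_on n UNIV a) \<and> (\<forall>x\<le>s. a x = 0) \<and> a t = 1"
proof (intro exI conjI allI impI)
  let ?a = "\<lambda>x. flat 1 (x + - s) * (1 / flat 1 (t - s))"
  show "Cn_on n UNIV ?a" for n
    by (intro open_UNIV Cn_on_mult Cn_on_compose_real[OF _ Cn_on_flat] Cn_on_add Cn_on_const
        Cn_on_bounded_linear[OF _ bounded_linear_ident])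
  show "?a x = 0" if "x \<le> s" for x using that by (simp add: flat_def)
  show "?a t = 1" using assms by (simp add: flat_def)
qed

section \<open>Prescribing the blown-up system\<close>

text \<open>One polynomial with free coefficients contains all four normal forms, so derivatives are
  computed once. Powers are spelled as products to match \<open>Cn_on_mult\<close>.\<close>

definition cubic :: "real \<Rightarrow> real \<Rightarrow> real \<Rightarrow> real \<Rightarrow> real \<Rightarrow> real \<Rightarrow> real \<Rightarrow> real \<Rightarrow> real" where
  "cubic \<alpha> \<beta> \<gamma> \<eta> \<mu> \<nu> u y = \<alpha> * u + \<beta> * y + \<gamma> * (u * u) + \<eta> * (y * y) + \<mu> * (u * y) + \<nu> * (u * (u * u))"

lemma Cn_on_cubic:
  assumes "open S" "Cn_on n S f" "Cn_on n S g"
  shows "Cn_on n S (\<lambda>x. cubic \<alpha> \<beta> \<gamma> \<eta> \<mu> \<nu> (f x) (g x))"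
  unfolding cubic_def using assms
  by (intro Cn_on_add Cn_on_mult Cn_on_const) auto

lemma monotonic_transition_Cn:
  assumes "monotonic_transition \<phi>" "n \<le> 3"
  shows "Cn_on n UNIV \<phi>"
  using assms by (auto simp: monotonic_transition_def Cr_on_def numeral_eq_enat)

text \<open>On the line \<open>deriv\<close> is the directional derivative in direction 1, so each
  \<open>step\<close> lowers the class by one; class 3 allows three of them.\<close>

lemma monotonic_transition_derivatives:
  assumes "monotonic_transition \<phi>"
  shows "(\<phi> has_real_derivative deriv \<phi> x) (at x)"
    and "(deriv \<phi> has_real_derivative deriv (deriv \<phi>) x) (at x)"
    and "(deriv (deriv \<phi>) has_real_derivative deriv (deriv (deriv \<phi>)) x) (at x)"
proof -
  have step: "(\<forall>x. f differentiable (at x)) \<and> Cn_on n UNIV (deriv f)" if "Cn_on (Suc n) UNIV f"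
    for n and f :: "real \<Rightarrow> real"
  proof -
    have d: "f differentiable (at x)" for x using that by simp
    then have "(f has_derivative (*) (deriv f x)) (at x)" for x
      unfolding has_field_derivative_def[symmetric] DERIV_deriv_iff_real_differentiable .
    then have "frechet_derivative f (at x) 1 = deriv f x" for x
      using fun_cong[OF frechet_derivative_at, of f "(*) (deriv f x)" x 1] by simp
    then have "Cn_on n UNIV (deriv f)"
      using Cn_on_frechet_derivative[OF that, of 1] by simp
    with d show ?thesis by blast
  qed
  have "Cn_on (Suc (Suc (Suc 0))) UNIV \<phi>"
    using monotonic_transition_Cn[OF assms, of 3] by (simp add: numeral_3_eq_3 del: Cn_on.simps)
  note 1 = step[OF this]
  note 2 = step[OF conjunct2[OF 1]]
  note 3 = step[OF conjunct2[OF 2]]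
  show "(\<phi> has_real_derivative deriv \<phi> x) (at x)"
    and "(deriv \<phi> has_real_derivative deriv (deriv \<phi>) x) (at x)"
    and "(deriv (deriv \<phi>) has_real_derivative deriv (deriv (deriv \<phi>)) x) (at x)"
    using 1 2 3 by (auto simp: DERIV_deriv_iff_real_differentiable)
qed

text \<open>By the mean value theorem \<open>\<phi>\<close> increases strictly on [-1, 1]: the
  intermediate point is interior, where the derivative is positive. The end values are -1 and
  1.\<close>

lemma monotonic_transition_at_0:
  assumes "monotonic_transition \<phi>"
  shows "-1 < \<phi> 0" "\<phi> 0 < 1"
proof -
  have less: "\<phi> a < \<phi> b" if ab: "-1 \<le> a" "a < b" "b \<le> 1" for a b
  proof -
    obtain z where "a < z" "z < b" "\<phi> b - \<phi> a = (b - a) * deriv \<phi> z"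
      using MVT2[OF ab(2)] monotonic_transition_derivatives(1)[OF assms] by blast
    moreover from this have "0 < (b - a) * deriv \<phi> z"
      using assms ab by (intro mult_pos_pos) (auto simp: monotonic_transition_def)
    ultimately show ?thesis by linarith
  qed
  show "-1 < \<phi> 0" "\<phi> 0 < 1"
    using less[of "-1" 0] less[of 0 1] assms by (auto simp: monotonic_transition_def)
qed

text \<open>While \<open>\<phi> x\<close> is close to \<open>\<phi> 0\<close> both cutoffs vanish,
  so the polynomial field is attained exactly, for every \<open>y\<close> and
  \<open>\<epsilon>\<close>, even if \<open>(\<epsilon> * x, y)\<close> leaves
  \<open>U\<close>.\<close>

lemma ex_family_with_prescribed_blowup:
  assumes "piecewise_smooth_vf r U X Y Z" "monotonic_transition \<phi>"
  obtains Zt \<delta> where "interpolating_family r U X Y Zt" "\<delta> > 0"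
    "\<And>x y \<epsilon>. \<bar>x\<bar> < \<delta> \<Longrightarrow> blowup_fast \<phi> Zt x y \<epsilon> = cubic \<alpha> \<beta> \<gamma> \<eta> \<mu> \<nu> (\<phi> x - \<phi> 0) y"
    "\<And>x y \<epsilon>. \<bar>x\<bar> < \<delta> \<Longrightarrow> blowup_slow \<phi> Zt x y \<epsilon> = 1"
proof -
  define c where "c = \<phi> 0"
  have c: "-1 < c" "c < 1"
    using monotonic_transition_at_0[OF assms(2)] by (auto simp: c_def)
  \<comment> \<open>The thresholds are midpoints: \<open>(c + 1) / 2\<close> is that of
    \<open>c\<close> and 1. As \<open>b\<close> is evaluated at \<open>- l\<close>,
    \<open>(1 - c) / 2\<close> stands for \<open>l = (c - 1) / 2\<close>, the midpoint of -1 and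
    \<open>c\<close>.\<close>
  then have lt: "(c + 1) / 2 < 1" "(1 - c) / 2 < 1" by auto
  obtain a :: "real \<Rightarrow> real" where a: "\<And>n. Cn_on n UNIV a" "\<And>x. x \<le> (c + 1) / 2 \<Longrightarrow> a x = 0" "a 1 = 1"
    using ex_smooth_cutoff[OF lt(1)] by blast
  obtain b :: "real \<Rightarrow> real" where b: "\<And>n. Cn_on n UNIV b" "\<And>x. x \<le> (1 - c) / 2 \<Longrightarrow> b x = 0" "b 1 = 1"
    using ex_smooth_cutoff[OF lt(2)] by blast
  define Zt where "Zt l p = a l *\<^sub>R X p + b (- l) *\<^sub>R Y p
      + (1 + (- 1) * a l + (- 1) * b (- l)) *\<^sub>R (cubic \<alpha> \<beta> \<gamma> \<eta> \<mu> \<nu> (l + - c) (snd p) *\<^sub>R (1, 0) + (0, 1))" for l p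
  have "interpolating_family r U X Y Zt"
    unfolding interpolating_family_def
  proof (intro conjI ballI exI)
    have U: "open U" using assms(1) by (simp add: piecewise_smooth_vf_def)
    \<comment> \<open>The cutoffs and the polynomial are smooth in \<open>l\<close> on the whole
      line, so the full cylinder over \<open>U\<close> serves as the neighbourhood.\<close>
    have V: "open (snd -` U :: (real \<times> real \<times> real) set)"
      by (intro open_vimage U continuous_on_snd continuous_on_id)
    then show "open (snd -` U :: (real \<times> real \<times> real) set)" .
    show "{-1..1} \<times> U \<subseteq> snd -` U" by auto
    show "Cr_on r (snd -` U) (\<lambda>(l, p). Zt l p)"
      unfolding Cr_on_def
    proof (intro allI impI)
      fix n assume "enat n \<le> r"
      then have XY: "Cn_on n U X" "Cn_on n U Y"
        using assms(1) by (auto simp: piecewise_smooth_vf_def Cr_on_def)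
      note XY' = XY[THEN Cn_on_compose_linear[OF U bounded_linear_snd]]
      note L = Cn_on_bounded_linear[OF V]
      have "Cn_on n (snd -` U) (\<lambda>q. Zt (fst q) (snd q))"
        unfolding Zt_def
        by (intro Cn_on_add[OF V] Cn_on_scaleR[OF V] Cn_on_mult[OF V] Cn_on_const[OF V] Cn_on_cubic[OF V]
            Cn_on_compose_real[OF V a(1)] Cn_on_compose_real[OF V b(1)]
            XY' L[OF bounded_linear_fst]
            L[OF bounded_linear_minus[OF bounded_linear_fst]] L[OF bounded_linear_snd_comp[OF bounded_linear_snd]])
      then show "Cn_on n (snd -` U) (\<lambda>(l, p). Zt l p)"
        by (simp add: case_prod_unfold)
    qed
    show "Zt (-1) p = Y p" "Zt 1 p = X p" for p
      using a(2)[of "-1"] b(2)[of "-1"] a(3) b(3) c by (auto simp: Zt_def zero_prod_def)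
  qed
  moreover obtain \<delta> where \<delta>: "\<delta> > 0" "\<And>x. \<bar>x\<bar> < \<delta> \<Longrightarrow> \<phi> x \<in> {(c - 1) / 2 <..< (c + 1) / 2}"
  proof -
    have "open (\<phi> -` {(c - 1) / 2 <..< (c + 1) / 2})"
      using monotonic_transition_Cn[OF assms(2), of 0] by (intro open_vimage) auto
    moreover have "0 \<in> \<phi> -` {(c - 1) / 2 <..< (c + 1) / 2}"
      using c by (simp add: c_def)
    ultimately obtain \<delta> where "\<delta> > 0" "ball 0 \<delta> \<subseteq> \<phi> -` {(c - 1) / 2 <..< (c + 1) / 2}"
      by (meson open_contains_ball)
    then show thesis by (intro that[of \<delta>]) (auto simp: subset_iff)
  qed
  moreover have "Zt (\<phi> x) p = (cubic \<alpha> \<beta> \<gamma> \<eta> \<mu> \<nu> (\<phi> x - \<phi> 0) (snd p), 1)" if "\<bar>x\<bar> < \<delta>" for x p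
    using \<delta>(2)[OF that] a(2)[of "\<phi> x"] b(2)[of "- \<phi> x"] by (simp add: Zt_def c_def)
  ultimately show ?thesis
    by (intro that[of Zt \<delta>]) (auto simp: blowup_fast_def blowup_slow_def)
qed

section \<open>Partial derivatives of the prescribed system\<close>

text \<open>The strip is open in the first variable and \<open>deriv\<close> depends only on values
  near the point.\<close>

lemma partial_x_cong:
  assumes "\<And>x y. \<bar>x\<bar> < \<delta> \<Longrightarrow> F x y = G x y" "\<bar>x\<bar> < \<delta>"
  shows "partial_x F x y = partial_x G x y"
proof -
  have "eventually (\<lambda>s. s \<in> {-\<delta><..<\<delta>}) (nhds x)"
    by (rule eventually_nhds_in_open) (use assms(2) in auto)
  then have "eventually (\<lambda>s. F s y = G s y) (nhds x)"
    by eventually_elim (use assms(1) in auto)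
  then show ?thesis by (simp add: partial_x_def deriv_cong_ev)
qed

lemma partial_y_cong:
  assumes "\<And>x y. \<bar>x\<bar> < \<delta> \<Longrightarrow> F x y = G x y" "\<bar>x\<bar> < \<delta>"
  shows "partial_y F x y = partial_y G x y"
  using assms by (simp add: partial_y_def)

text \<open>All conditions at the origin are local, so \<open>f\<close> and \<open>g\<close> are
  constrained only on a strip around \<open>x = 0\<close>.\<close>

locale prescribed_blowup =
  fixes \<phi> :: "real \<Rightarrow> real" and f g :: "real \<Rightarrow> real \<Rightarrow> real \<Rightarrow> real"
    and \<delta> \<alpha> \<beta> \<gamma> \<eta> \<mu> \<nu> :: real
  assumes \<phi>: "monotonic_transition \<phi>" and \<delta>: "\<delta> > 0"
    and f: "\<And>x y \<epsilon>. \<bar>x\<bar> < \<delta> \<Longrightarrow> f x y \<epsilon> = cubic \<alpha> \<beta> \<gamma> \<eta> \<mu> \<nu> (\<phi> x - \<phi> 0) y"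
    and g: "\<And>x y \<epsilon>. \<bar>x\<bar> < \<delta> \<Longrightarrow> g x y \<epsilon> = 1"
begin

abbreviation F :: "real \<Rightarrow> real \<Rightarrow> real" where "F x y \<equiv> f x y 0"
abbreviation u :: "real \<Rightarrow> real" where "u x \<equiv> \<phi> x - \<phi> 0"

lemmas D = monotonic_transition_derivatives[OF \<phi>]

lemma deriv_pos: "deriv \<phi> 0 > 0"
  using \<phi> by (simp add: monotonic_transition_def)

text \<open>On the strip \<open>f\<close> is a polynomial in \<open>\<phi> x\<close> and
  \<open>y\<close>, so it inherits class 3 from \<open>\<phi>\<close>.\<close>

lemma slow_fast: "slow_fast_near_origin f g"
  unfolding slow_fast_near_origin_def
proof (intro exI conjI)
  let ?N = "{-\<delta><..<\<delta>} \<times> (UNIV :: (real \<times> real) set)"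
  show N: "open ?N" by (intro open_Times) auto
  show "(0, 0, 0) \<in> ?N" using \<delta> by simp
  show "Cr_on 3 ?N (\<lambda>(x, y, \<epsilon>). f x y \<epsilon>)"
    unfolding Cr_on_def
  proof (intro allI impI)
    fix n assume "enat n \<le> 3"
    then have n: "Cn_on n UNIV \<phi>"
      by (intro monotonic_transition_Cn[OF \<phi>]) (simp add: numeral_eq_enat)
    have "Cn_on n ?N (\<lambda>q. cubic \<alpha> \<beta> \<gamma> \<eta> \<mu> \<nu> (\<phi> (fst q) + - \<phi> 0) (fst (snd q)))"
      by (intro Cn_on_cubic[OF N] Cn_on_add[OF N] Cn_on_compose_real[OF N n] Cn_on_const[OF N]
          Cn_on_bounded_linear[OF N bounded_linear_fst]
          Cn_on_bounded_linear[OF N bounded_linear_fst_comp[OF bounded_linear_snd]])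
    then show "Cn_on n ?N (\<lambda>(x, y, \<epsilon>). f x y \<epsilon>)"
      by (rule Cn_on_cong[OF N, THEN iffD1, rotated]) (auto simp: f)
  qed
  show "Cr_on 3 ?N (\<lambda>(x, y, \<epsilon>). g x y \<epsilon>)"
    unfolding Cr_on_def
    by (intro allI impI Cn_on_cong[OF N, THEN iffD1, OF _ Cn_on_const[OF N, of _ 1]]) (auto simp: g)
qed

lemma F_origin: "(0, 0) \<in> critical_set f"
  using \<delta> by (simp add: critical_set_def f cubic_def)

lemma g_origin: "g 0 0 0 = 1"
  using \<delta> g by simp

text \<open>Stated on the whole strip, so that the formula can be differentiated again.\<close>

lemma F_x:
  assumes "\<bar>x\<bar> < \<delta>"
  shows "partial_x F x y = (\<alpha> + 2 * \<gamma> * u x + \<mu> * y + 3 * \<nu> * (u x)\<^sup>2) * deriv \<phi> x"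
proof -
  have "partial_x F x y = partial_x (\<lambda>x y. cubic \<alpha> \<beta> \<gamma> \<eta> \<mu> \<nu> (u x) y) x y"
    by (rule partial_x_cong[OF _ assms]) (simp add: f)
  also have "\<dots> = (\<alpha> + 2 * \<gamma> * u x + \<mu> * y + 3 * \<nu> * (u x)\<^sup>2) * deriv \<phi> x"
    unfolding partial_x_def cubic_def
    by (rule DERIV_imp_deriv) (auto intro!: derivative_eq_intros D simp: algebra_simps power2_eq_square)
  finally show ?thesis .
qed

lemma F_y:
  assumes "\<bar>x\<bar> < \<delta>"
  shows "partial_y F x y = \<beta> + 2 * \<eta> * y + \<mu> * u x"
proof -
  have "partial_y F x y = partial_y (\<lambda>x y. cubic \<alpha> \<beta> \<gamma> \<eta> \<mu> \<nu> (u x) y) x y"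
    by (rule partial_y_cong[OF _ assms]) (simp add: f)
  also have "\<dots> = \<beta> + 2 * \<eta> * y + \<mu> * u x"
    unfolding partial_y_def cubic_def
    by (rule DERIV_imp_deriv) (auto intro!: derivative_eq_intros simp: algebra_simps)
  finally show ?thesis .
qed

lemma F_xx:
  assumes "\<bar>x\<bar> < \<delta>"
  shows "partial_x (partial_x F) x y = (2 * \<gamma> + 6 * \<nu> * u x) * (deriv \<phi> x)\<^sup>2
    + (\<alpha> + 2 * \<gamma> * u x + \<mu> * y + 3 * \<nu> * (u x)\<^sup>2) * deriv (deriv \<phi>) x"
proof -
  have "partial_x (partial_x F) x y
      = partial_x (\<lambda>x y. (\<alpha> + 2 * \<gamma> * u x + \<mu> * y + 3 * \<nu> * (u x)\<^sup>2) * deriv \<phi> x) x y"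
    by (rule partial_x_cong[OF _ assms]) (simp add: F_x)
  also have "\<dots> = (2 * \<gamma> + 6 * \<nu> * u x) * (deriv \<phi> x)\<^sup>2
    + (\<alpha> + 2 * \<gamma> * u x + \<mu> * y + 3 * \<nu> * (u x)\<^sup>2) * deriv (deriv \<phi>) x"
    unfolding partial_x_def
    by (rule DERIV_imp_deriv) (auto intro!: derivative_eq_intros D simp: algebra_simps power2_eq_square)
  finally show ?thesis .
qed

lemma F_xy:
  assumes "\<bar>x\<bar> < \<delta>"
  shows "partial_y (partial_x F) x y = \<mu> * deriv \<phi> x"
proof -
  have "partial_y (partial_x F) x y
      = partial_y (\<lambda>x y. (\<alpha> + 2 * \<gamma> * u x + \<mu> * y + 3 * \<nu> * (u x)\<^sup>2) * deriv \<phi> x) x y"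
    by (rule partial_y_cong[OF _ assms]) (simp add: F_x)
  also have "\<dots> = \<mu> * deriv \<phi> x"
    unfolding partial_y_def
    by (rule DERIV_imp_deriv) (auto intro!: derivative_eq_intros simp: algebra_simps)
  finally show ?thesis .
qed

lemma F_yx:
  assumes "\<bar>x\<bar> < \<delta>"
  shows "partial_x (partial_y F) x y = \<mu> * deriv \<phi> x"
proof -
  have "partial_x (partial_y F) x y = partial_x (\<lambda>x y. \<beta> + 2 * \<eta> * y + \<mu> * u x) x y"
    by (rule partial_x_cong[OF _ assms]) (simp add: F_y)
  also have "\<dots> = \<mu> * deriv \<phi> x"
    unfolding partial_x_def
    by (rule DERIV_imp_deriv) (auto intro!: derivative_eq_intros D)
  finally show ?thesis .
qed

lemma F_yy:
  assumes "\<bar>x\<bar> < \<delta>"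
  shows "partial_y (partial_y F) x y = 2 * \<eta>"
proof -
  have "partial_y (partial_y F) x y = partial_y (\<lambda>x y. \<beta> + 2 * \<eta> * y + \<mu> * u x) x y"
    by (rule partial_y_cong[OF _ assms]) (simp add: F_y)
  also have "\<dots> = 2 * \<eta>"
    unfolding partial_y_def
    by (rule DERIV_imp_deriv) (auto intro!: derivative_eq_intros)
  finally show ?thesis .
qed

lemma F_xxx:
  "partial_x (partial_x (partial_x F)) 0 0 =
    6 * \<nu> * deriv \<phi> 0 ^ 3 + 6 * \<gamma> * deriv \<phi> 0 * deriv (deriv \<phi>) 0 + \<alpha> * deriv (deriv (deriv \<phi>)) 0"
proof -
  have "partial_x (partial_x (partial_x F)) 0 0
      = partial_x (\<lambda>x y. (2 * \<gamma> + 6 * \<nu> * u x) * (deriv \<phi> x)\<^sup>2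
          + (\<alpha> + 2 * \<gamma> * u x + \<mu> * y + 3 * \<nu> * (u x)\<^sup>2) * deriv (deriv \<phi>) x) 0 0"
    by (rule partial_x_cong[of \<delta>]) (use \<delta> in \<open>simp_all add: F_xx\<close>)
  also have "\<dots> = 6 * \<nu> * deriv \<phi> 0 ^ 3 + 6 * \<gamma> * deriv \<phi> 0 * deriv (deriv \<phi>) 0
      + \<alpha> * deriv (deriv (deriv \<phi>)) 0"
    unfolding partial_x_def
    by (rule DERIV_imp_deriv)
      (auto intro!: derivative_eq_intros D simp: algebra_simps power2_eq_square power3_eq_cube)
  finally show ?thesis .
qed

lemma normally_hyperbolic: "\<alpha> \<noteq> 0 \<Longrightarrow> normally_hyperbolic_origin f g"
  using \<delta> deriv_pos by (simp add: normally_hyperbolic_origin_def slow_fast F_origin F_x)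

text \<open>With \<open>\<alpha> = 0\<close> the second derivative of \<open>\<phi>\<close> drops
  out of \<open>F_xx\<close> at the origin, leaving \<open>2 * \<gamma>\<close> times the square of
  \<open>deriv \<phi> 0\<close>.\<close>

lemma SF_fold: "\<alpha> = 0 \<Longrightarrow> \<beta> \<noteq> 0 \<Longrightarrow> \<gamma> \<noteq> 0 \<Longrightarrow> SF_fold_origin f g"
  using \<delta> deriv_pos by (simp add: SF_fold_origin_def slow_fast F_origin g_origin F_x F_xx F_y)

text \<open>Writing d for \<open>deriv \<phi> 0\<close>, the Hessian has diagonal entries
  \<open>2 * \<gamma> * d^2\<close> and \<open>2 * \<eta>\<close> and off-diagonal entries
  \<open>\<mu> * d\<close>, so the sign of its determinant is that of
  \<open>4 * \<gamma> * \<eta> - \<mu>^2\<close>.\<close>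

lemma SF_transcritical:
  assumes "\<alpha> = 0" "\<beta> = 0" "\<gamma> \<noteq> 0" "4 * \<gamma> * \<eta> < \<mu>\<^sup>2"
  shows "SF_transcritical_origin f g"
proof -
  have "det (Hessian F 0 0) = (4 * \<gamma> * \<eta> - \<mu>\<^sup>2) * (deriv \<phi> 0)\<^sup>2"
    using \<delta> assms by (simp add: Hessian_def det_2 F_xx F_xy F_yx F_yy algebra_simps power2_eq_square)
  also have "\<dots> < 0"
    using assms deriv_pos by (intro mult_neg_pos) auto
  finally show ?thesis
    using \<delta> deriv_pos assms
    by (simp add: SF_transcritical_origin_def slow_fast F_origin g_origin F_x F_xx F_y)
qed

text \<open>With \<open>\<alpha> = \<gamma> = 0\<close> the higher derivatives of
  \<open>\<phi>\<close> disappear from \<open>F_xxx\<close>, which becomes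
  \<open>6 * \<nu> * deriv \<phi> 0 ^ 3\<close>.\<close>

lemma SF_pitchfork:
  "\<alpha> = 0 \<Longrightarrow> \<beta> = 0 \<Longrightarrow> \<gamma> = 0 \<Longrightarrow> \<mu> \<noteq> 0 \<Longrightarrow> \<nu> \<noteq> 0 \<Longrightarrow> SF_pitchfork_origin f g"
  using \<delta> deriv_pos
  by (simp add: SF_pitchfork_origin_def slow_fast F_origin g_origin F_x F_xx F_y F_xy F_xxx)

end

theorem theorem3:
  fixes r :: enat and U :: "(real \<times> real) set"
    and X Y :: vector_field and Z :: "real \<times> real \<Rightarrow> (real \<times> real) set"
    and \<phi> :: "real \<Rightarrow> real"
  assumes "piecewise_smooth_vf r U X Y Z"
    and "monotonic_transition \<phi>"
  shows "(\<exists>Zt. interpolating_family r U X Y Zt \<and>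
            normally_hyperbolic_origin (blowup_fast \<phi> Zt) (blowup_slow \<phi> Zt)) \<and>
         (\<exists>Zt. interpolating_family r U X Y Zt \<and>
            SF_fold_origin (blowup_fast \<phi> Zt) (blowup_slow \<phi> Zt)) \<and>
         (\<exists>Zt. interpolating_family r U X Y Zt \<and>
            SF_transcritical_origin (blowup_fast \<phi> Zt) (blowup_slow \<phi> Zt)) \<and>
         (\<exists>Zt. interpolating_family r U X Y Zt \<and>
            SF_pitchfork_origin (blowup_fast \<phi> Zt) (blowup_slow \<phi> Zt))"
proof -
  have family: "\<exists>Zt \<delta>. interpolating_family r U X Y Zt \<and>
      prescribed_blowup \<phi> (blowup_fast \<phi> Zt) (blowup_slow \<phi> Zt) \<delta> \<alpha> \<beta> \<gamma> \<eta> \<mu> \<nu>" for \<alpha> \<beta> \<gamma> \<eta> \<mu> \<nu>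
    using ex_family_with_prescribed_blowup[OF assms, of \<alpha> \<beta> \<gamma> \<eta> \<mu> \<nu>] assms(2)
    unfolding prescribed_blowup_def by metis
  show ?thesis
    \<comment> \<open>The coefficient lists encode \<open>u\<close>, \<open>y + u^2\<close>,
      \<open>u^2 - y^2\<close> and \<open>u * y - u^3\<close>; the determinant condition for the
      third reads -4 < 0.\<close>
    using family[of 1 0 0 0 0 0] family[of 0 1 1 0 0 0] family[of 0 0 1 "-1" 0 0] family[of 0 0 0 0 1 "-1"]
      prescribed_blowup.normally_hyperbolic[where \<alpha> = 1]
      prescribed_blowup.SF_fold[where \<alpha> = 0 and \<beta> = 1 and \<gamma> = 1]
      prescribed_blowup.SF_transcritical[where \<alpha> = 0 and \<beta> = 0 and \<gamma> = 1 and \<eta> = "-1" and \<mu> = 0]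
      prescribed_blowup.SF_pitchfork[where \<alpha> = 0 and \<beta> = 0 and \<gamma> = 0 and \<mu> = 1 and \<nu> = "-1"]
    by auto
qed

end
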